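(* Let $R$ be a finite commutative principal ideal ring with identity, and write $R\cong R_1\times\cdots\times R_t$ as its canonical decomposition into finite commutative local principal ideal rings. The following are equivalent. (1) $\mathrm{AGL}_1(R)$ contains a cross-commuting nonabelian square. (2) There exist distinct indices $i\neq j$ in $\{1,\dots,t\}$ such that $\mathrm{AGL}_1(R_i)$ and $\mathrm{AGL}_1(R_j)$ each contain a noncommuting pair of elements. (3) At least two of the local factors $R_k$ (i.e. for at least two distinct indices $k\in\{1,\dots,t\}$) are not isomorphic to $\mathbb{F}_2$.
   Context: For a commutative ring $R$ with identity, $\mathrm{AGL}_1(R)$ is the group (under composition) of affine permutations $x\mapsto ax+b$ of $R$ with $a\in R^\times$ and $b\in R$; identifying such a map with the pair $(a,b)$, the composition law is $(a,b)\circ(c,d)=(ac,ad+b)$. A principal ideal ring is a ring in which every ideal is principal (zero divisors are allowed). A cross-commuting nonabelian square in $\mathrm{AGL}_1(R)$ is a quadruple $(F_0,F_1,G_0,G_1)$ of elements of $\mathrm{AGL}_1(R)$ such that $F_i$ commutes with $G_j$ for all $i,j\in\{0,1\}$, but $F_0$ and $F_1$ do not commute, and $G_0$ and $G_1$ do not commute. *)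

theory Defs
  imports "HOL-Algebra.Algebra" "HOL-Number_Theory.Residues"
begin

locale principal_ideal_ring = cring +
  assumes all_ideals_principal: "ideal I R \<Longrightarrow> principalideal I R"

locale local_ring = cring +
  assumes unique_maximal_ideal: "\<exists>!M. maximalideal M R"

(* Restricted to the carrier, so that equality of affine maps is equality as maps on R. *)
definition affine_map :: "('a, 'm) ring_scheme \<Rightarrow> 'a \<Rightarrow> 'a \<Rightarrow> 'a \<Rightarrow> 'a" where
  "affine_map R a b = (\<lambda>x\<in>carrier R. a \<otimes>\<^bsub>R\<^esub> x \<oplus>\<^bsub>R\<^esub> b)"

definition AGL1 :: "('a, 'm) ring_scheme \<Rightarrow> ('a \<Rightarrow> 'a) monoid" where
  "AGL1 R = (BijGroup (carrier R))
     \<lparr>carrier := {affine_map R a b | a b. a \<in> Units R \<and> b \<in> carrier R}\<rparr>"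

definition commuting :: "('g, 'm) monoid_scheme \<Rightarrow> 'g \<Rightarrow> 'g \<Rightarrow> bool" where
  "commuting G x y \<longleftrightarrow> x \<otimes>\<^bsub>G\<^esub> y = y \<otimes>\<^bsub>G\<^esub> x"

definition has_noncommuting_pair :: "('g, 'm) monoid_scheme \<Rightarrow> bool" where
  "has_noncommuting_pair G \<longleftrightarrow> (\<exists>x\<in>carrier G. \<exists>y\<in>carrier G. \<not> commuting G x y)"

definition cross_commuting_nonabelian_square ::
    "('g, 'm) monoid_scheme \<Rightarrow> 'g \<Rightarrow> 'g \<Rightarrow> 'g \<Rightarrow> 'g \<Rightarrow> bool" where
  "cross_commuting_nonabelian_square G F0 F1 G0 G1 \<longleftrightarrow>
     {F0, F1, G0, G1} \<subseteq> carrier G \<and>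
     (\<forall>F\<in>{F0, F1}. \<forall>H\<in>{G0, G1}. commuting G F H) \<and>
     \<not> commuting G F0 F1 \<and> \<not> commuting G G0 G1"

(* The multiplication of BijGroup is meaningful on bijections only; the following facts
   show that it is the expected composition law on affine maps. *)

context cring
begin

lemma affine_map_Bij:
  assumes "a \<in> Units R" "b \<in> carrier R"
  shows "affine_map R a b \<in> Bij (carrier R)"
proof -
  have a: "a \<in> carrier R" "inv a \<in> carrier R" "inv a \<otimes> a = \<one>" "a \<otimes> inv a = \<one>"
    using assms(1) by auto
  have "bij_betw (affine_map R a b) (carrier R) (carrier R)"
  proof (rule bij_betwI[where g = "\<lambda>y. inv a \<otimes> (y \<ominus> b)"])
    show "affine_map R a b \<in> carrier R \<rightarrow> carrier R"
      using a assms by (auto simp: affine_map_def)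
    show "(\<lambda>y. inv a \<otimes> (y \<ominus> b)) \<in> carrier R \<rightarrow> carrier R"
      using a assms by auto
    show "inv a \<otimes> (affine_map R a b x \<ominus> b) = x" if x: "x \<in> carrier R" for x
    proof -
      have "a \<otimes> x \<oplus> b \<ominus> b = a \<otimes> x"
        using a assms x by (simp add: minus_eq a_assoc r_neg)
      then show ?thesis
        using a x by (simp add: affine_map_def m_assoc[symmetric])
    qed
    show "affine_map R a b (inv a \<otimes> (y \<ominus> b)) = y" if y: "y \<in> carrier R" for y
    proof -
      have "a \<otimes> (inv a \<otimes> (y \<ominus> b)) = y \<ominus> b"
        using a assms y by (simp add: m_assoc[symmetric])
      then show ?thesis
        using a assms y by (simp add: affine_map_def minus_eq a_assoc l_neg)
    qed
  qed
  then show ?thesis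
    by (simp add: Bij_def affine_map_def)
qed

lemma AGL1_mult:
  assumes "a \<in> Units R" "b \<in> carrier R" "c \<in> Units R" "d \<in> carrier R"
  shows "affine_map R a b \<otimes>\<^bsub>AGL1 R\<^esub> affine_map R c d = affine_map R (a \<otimes> c) (a \<otimes> d \<oplus> b)"
proof -
  have "a \<in> carrier R" "c \<in> carrier R"
    using assms by auto
  then have "compose (carrier R) (affine_map R a b) (affine_map R c d)
      = affine_map R (a \<otimes> c) (a \<otimes> d \<oplus> b)"
    using assms(2,4)
    by (auto simp: compose_def affine_map_def r_distr m_assoc a_assoc)
  then show ?thesis
    using assms by (simp add: AGL1_def BijGroup_def affine_map_Bij)
qed

lemma AGL1_group: "group (AGL1 R)"
proof (rule groupI)
  have carr: "carrier (AGL1 R) = {affine_map R a b | a b. a \<in> Units R \<and> b \<in> carrier R}"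
    by (simp add: AGL1_def)
  have id: "\<one>\<^bsub>AGL1 R\<^esub> = affine_map R \<one> \<zero>"
    by (auto simp: AGL1_def BijGroup_def affine_map_def)
  show "\<one>\<^bsub>AGL1 R\<^esub> \<in> carrier (AGL1 R)"
    unfolding id carr by blast
  show "x \<otimes>\<^bsub>AGL1 R\<^esub> y \<in> carrier (AGL1 R)"
    if xy: "x \<in> carrier (AGL1 R)" "y \<in> carrier (AGL1 R)" for x y
  proof -
    obtain a b c d where *: "a \<in> Units R" "b \<in> carrier R" "c \<in> Units R" "d \<in> carrier R"
      and "x = affine_map R a b" "y = affine_map R c d"
      using xy unfolding carr by blast
    then have "x \<otimes>\<^bsub>AGL1 R\<^esub> y = affine_map R (a \<otimes> c) (a \<otimes> d \<oplus> b)"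
      using AGL1_mult by simp
    moreover have "a \<otimes> c \<in> Units R" "a \<otimes> d \<oplus> b \<in> carrier R"
      using * by auto
    ultimately show ?thesis
      unfolding carr by blast
  qed
  have sub: "x \<in> carrier (BijGroup (carrier R))" if "x \<in> carrier (AGL1 R)" for x
    using that affine_map_Bij unfolding carr by (auto simp: BijGroup_def)
  have mult: "x \<otimes>\<^bsub>AGL1 R\<^esub> y = x \<otimes>\<^bsub>BijGroup (carrier R)\<^esub> y" for x y
    by (simp add: AGL1_def)
  interpret B: group "BijGroup (carrier R)"
    by (rule group_BijGroup)
  show "x \<otimes>\<^bsub>AGL1 R\<^esub> y \<otimes>\<^bsub>AGL1 R\<^esub> z = x \<otimes>\<^bsub>AGL1 R\<^esub> (y \<otimes>\<^bsub>AGL1 R\<^esub> z)"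
    if "x \<in> carrier (AGL1 R)" "y \<in> carrier (AGL1 R)" "z \<in> carrier (AGL1 R)" for x y z
    unfolding mult using that by (intro B.m_assoc sub)
  show "\<one>\<^bsub>AGL1 R\<^esub> \<otimes>\<^bsub>AGL1 R\<^esub> x = x" if "x \<in> carrier (AGL1 R)" for x
    using B.l_one[OF sub[OF that]] by (simp add: AGL1_def)
  show "\<exists>y\<in>carrier (AGL1 R). y \<otimes>\<^bsub>AGL1 R\<^esub> x = \<one>\<^bsub>AGL1 R\<^esub>"
    if x: "x \<in> carrier (AGL1 R)" for x
  proof -
    obtain a b where ab: "a \<in> Units R" "b \<in> carrier R" "x = affine_map R a b"
      using x unfolding carr by blast
    define y where "y = affine_map R (inv a) (\<ominus> (inv a \<otimes> b))"
    have "y \<otimes>\<^bsub>AGL1 R\<^esub> x = \<one>\<^bsub>AGL1 R\<^esub>"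
      unfolding y_def ab(3) id using ab(1,2) by (subst AGL1_mult) (auto simp: r_neg)
    moreover have "y \<in> carrier (AGL1 R)"
      unfolding y_def carr using ab by blast
    ultimately show ?thesis by blast
  qed
qed

end

end

theory Submission
  imports Defs
begin

text \<open>
  The maps \<open>a x + b\<close> and \<open>c x + d\<close> commute iff the vectors \<open>(a - 1, b)\<close> and
  \<open>(c - 1, d)\<close> have vanishing determinant, which can be tested factor by factor. In a
  local principal ideal ring any two elements are comparable under divisibility, so one
  of the eight entries of a hypothetical square divides all the others; call it \<open>z\<close> and
  say that it belongs to \<open>F0\<close>. Modulo the annihilator of \<open>z^2\<close>, the vectors \<open>G0 / z\<close> and
  \<open>G1 / z\<close> are both multiples of \<open>F0 / z\<close>, so the determinant of \<open>G0\<close> and \<open>G1\<close> vanishes,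
  a contradiction. Hence the two noncommuting pairs of a square over a product live in
  different local factors. Finally, an affine group is nonabelian iff the ring has a unit
  other than \<open>1\<close>, and the only finite local ring without such a unit is the field with
  two elements.
\<close>

section \<open>Finite local rings: nonunits and divisibility\<close>

lemma (in ring) proper_ideal_in_maximalideal:
  assumes "finite (carrier R)" "ideal I R" "I \<noteq> carrier R"
  shows "\<exists>M. maximalideal M R \<and> I \<subseteq> M"
proof -
  let ?P = "{J. ideal J R \<and> J \<noteq> carrier R}"
  have "?P \<subseteq> Pow (carrier R)"
    by (auto dest: ideal.Icarr)
  then have "finite ?P"
    using assms(1) finite_subset by blast
  then obtain M where M: "M \<in> ?P" "I \<subseteq> M" and max: "\<And>J. J \<in> ?P \<Longrightarrow> M \<subseteq> J \<Longrightarrow> M = J"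
    using finite_has_maximal2[of ?P I] assms by auto
  then have "maximalideal M R"
    by (intro maximalidealI) auto
  then show ?thesis
    using M by blast
qed

lemma (in cring) nonunit_in_maximalideal:
  assumes "finite (carrier R)" "x \<in> carrier R" "x \<notin> Units R"
  shows "\<exists>M. maximalideal M R \<and> x \<in> M"
proof -
  have "PIdl x \<noteq> carrier R"
  proof
    assume "PIdl x = carrier R"
    then obtain y where "y \<in> carrier R" "\<one> = y \<otimes> x"
      using one_closed unfolding cgenideal_def by blast
    then show False
      using assms m_comm unfolding Units_def by auto
  qed
  then show ?thesis
    using proper_ideal_in_maximalideal cgenideal_ideal cgenideal_self assms by blast
qed

context local_ring
begin

text \<open>Two nonunits would both lie in the unique maximal ideal, and so would their sum
  \<one>.\<close>

lemma nonunit_add_complement: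
  assumes "finite (carrier R)" "x \<in> carrier R" "y \<in> carrier R" "x \<oplus> y = \<one>"
  shows "x \<in> Units R \<or> y \<in> Units R"
proof (rule ccontr)
  assume "\<not> ?thesis"
  then obtain M where M: "maximalideal M R" "x \<in> M" "y \<in> M"
    using nonunit_in_maximalideal[OF assms(1)] unique_maximal_ideal assms(2,3) by metis
  then interpret maximalideal M R by simp
  have "\<one> \<in> M"
    using a_closed[OF M(2,3)] assms(4) by simp
  then show False
    using I_notcarr one_imp_carrier by simp
qed

text \<open>In the zero ring every ideal is the whole carrier, so none is maximal.\<close>

lemma one_not_zero: "\<one> \<noteq> \<zero>"
proof
  assume "\<one> = \<zero>"
  then have "carrier R = {\<zero>}"
    by (rule one_zeroD)
  moreover obtain M where "maximalideal M R"
    using unique_maximal_ideal by blast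
  ultimately show False
    by (metis maximalideal.I_notcarr maximalideal.axioms(1) ideal.Icarr
        additive_subgroup.zero_closed ideal.axioms(1) singletonD subsetI subset_antisym
        empty_subsetI insert_subset)
qed

text \<open>Let \<open>g\<close> generate the ideal spanned by \<open>a\<close> and
  \<open>b\<close>, with \<open>a = x g\<close> and \<open>b = y g\<close>. If \<open>x\<close> or
  \<open>y\<close> is a unit, then \<open>a\<close> or \<open>b\<close> is associated to
  \<open>g\<close> and divides the other. If neither is, an argument in the style of Nakayama forces
  \<open>g\<close> to vanish.\<close>

lemma divides_total:
  assumes fin: "finite (carrier R)" and pir: "principal_ideal_ring R"
    and a: "a \<in> carrier R" and b: "b \<in> carrier R"
  shows "a divides b \<or> b divides a"
proof -
  have "ideal (PIdl a <+> PIdl b) R"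
    using a b cgenideal_ideal add_ideals by blast
  then obtain g where g: "g \<in> carrier R" and gen: "PIdl a <+> PIdl b = PIdl g"
    using principal_ideal_ring.all_ideals_principal[OF pir] principalideal.generate
      cgenideal_eq_genideal by metis
  have mem: "r \<otimes> a \<oplus> s \<otimes> b \<in> PIdl g" if "r \<in> carrier R" "s \<in> carrier R" for r s
    using that unfolding gen[symmetric] unfolding set_add_def' cgenideal_def by blast
  have "a \<in> PIdl g" "b \<in> PIdl g"
    using mem[of \<one> \<zero>] mem[of \<zero> \<one>] a b by auto
  then obtain x y where x: "x \<in> carrier R" "a = x \<otimes> g" and y: "y \<in> carrier R" "b = y \<otimes> g"
    unfolding cgenideal_def by blast
  have "g \<in> PIdl a <+> PIdl b"
    unfolding gen using cgenideal_self[OF g] by blast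
  then obtain r s where rs: "r \<in> carrier R" "s \<in> carrier R" "g = r \<otimes> a \<oplus> s \<otimes> b"
    unfolding set_add_def' cgenideal_def by blast
  note carr = x(1) y(1) rs(1,2)
  have unit_div: "u \<otimes> g divides v \<otimes> g" if u: "u \<in> Units R" and v: "v \<in> carrier R" for u v
  proof -
    have "u \<otimes> g \<otimes> (inv u \<otimes> v) = (u \<otimes> inv u) \<otimes> (v \<otimes> g)"
      using u v g Units_closed Units_inv_closed by (simp add: m_ac del: Units_r_inv)
    then have "v \<otimes> g = u \<otimes> g \<otimes> (inv u \<otimes> v)"
      using u v g by simp
    then show ?thesis
      using u v by (intro dividesI) auto
  qed
  show ?thesis
  proof (cases "x \<in> Units R \<or> y \<in> Units R")
    case True
    then show ?thesis
      using unit_div x y by auto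
  next
    case False
    have prod: "v \<in> Units R" if "u \<otimes> v \<in> Units R" "u \<in> carrier R" "v \<in> carrier R" for u v
      using that unit_factor[of v u] m_comm[of u v] by simp
    \<comment> \<open>Substituting \<open>a = x g\<close> and \<open>b = y g\<close> into
      \<open>g = r a + s b\<close> gives \<open>g = m g\<close>.\<close>
    define m where "m = r \<otimes> x \<oplus> s \<otimes> y"
    have m: "m \<in> carrier R"
      using carr by (simp add: m_def)
    \<comment> \<open>Dividing by a unit \<open>m\<close> would write \<one> as a multiple of
      \<open>x\<close> plus a multiple of \<open>y\<close>. One of these multiples would be a unit,
      and with it \<open>x\<close> or \<open>y\<close>.\<close>
    have "m \<notin> Units R"
    proof
      assume unit: "m \<in> Units R"
      have i: "inv m \<in> carrier R" using unit by simp
      have "(inv m \<otimes> r) \<otimes> x \<oplus> (inv m \<otimes> s) \<otimes> y = inv m \<otimes> m"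
        using carr i by (simp add: m_def r_distr m_assoc)
      also have "\<dots> = \<one>"
        using unit by simp
      finally have "(inv m \<otimes> r) \<otimes> x \<in> Units R \<or> (inv m \<otimes> s) \<otimes> y \<in> Units R"
        using nonunit_add_complement[OF fin, of "(inv m \<otimes> r) \<otimes> x" "(inv m \<otimes> s) \<otimes> y"] carr i
        by simp
      then show False
        using prod False carr i m_closed by blast
    qed
    moreover have "m \<oplus> (\<one> \<ominus> m) = \<one>"
      using m by algebra
    ultimately have unit: "\<one> \<ominus> m \<in> Units R"
      using nonunit_add_complement[OF fin m, of "\<one> \<ominus> m"] m by simp
    have "g = r \<otimes> (x \<otimes> g) \<oplus> s \<otimes> (y \<otimes> g)"
      using rs(3) x(2) y(2) by simp
    also have "\<dots> = m \<otimes> g"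
      using carr g by (simp add: m_def l_distr m_assoc)
    \<comment> \<open>The unit \<open>\<one> \<ominus> m\<close> annihilates \<open>g\<close>, so
      \<open>g\<close>, and with it \<open>a\<close> and \<open>b\<close>, is zero.\<close>
    finally have "g \<ominus> m \<otimes> g = \<zero>"
      using g m by (metis minus_eq r_neg m_closed)
    moreover have "(\<one> \<ominus> m) \<otimes> g = g \<ominus> m \<otimes> g"
      using g m by algebra
    moreover have "g = inv (\<one> \<ominus> m) \<otimes> ((\<one> \<ominus> m) \<otimes> g)"
      using unit g Units_closed[OF unit] by (simp add: m_assoc[symmetric])
    ultimately have "g = \<zero>"
      using unit by simp
    then show ?thesis
      using x y by (auto intro: dividesI[of \<one>])
  qed
qed

end

section \<open>Commutation of affine maps\<close>

lemma (in cring) affine_map_eq_iff: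
  assumes "a \<in> carrier R" "b \<in> carrier R" "c \<in> carrier R" "d \<in> carrier R"
  shows "affine_map R a b = affine_map R c d \<longleftrightarrow> a = c \<and> b = d"
proof
  assume eq: "affine_map R a b = affine_map R c d"
  have "a \<otimes> x \<oplus> b = c \<otimes> x \<oplus> d" if "x \<in> carrier R" for x
    using fun_cong[OF eq, of x] that by (simp add: affine_map_def)
  from this[of \<zero>] this[of \<one>] show "a = c \<and> b = d"
    using assms by simp
qed simp

text \<open>Both compositions have the same multiplier, so only their translation parts need to be
  compared.\<close>

lemma (in cring) commuting_AGL1_iff:
  assumes "a \<in> Units R" "b \<in> carrier R" "c \<in> Units R" "d \<in> carrier R"
  shows "commuting (AGL1 R) (affine_map R a b) (affine_map R c d)
    \<longleftrightarrow> a \<otimes> d \<oplus> b = c \<otimes> b \<oplus> d"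
proof -
  have "a \<in> carrier R" "c \<in> carrier R"
    using assms by auto
  then show ?thesis
    using assms by (simp add: commuting_def AGL1_mult affine_map_eq_iff m_comm)
qed

lemma carrier_AGL1: "carrier (AGL1 R) = {affine_map R a b | a b. a \<in> Units R \<and> b \<in> carrier R}"
  by (simp add: AGL1_def)

lemma (in cring) has_noncommuting_pairI:
  assumes "a \<in> Units R" "b \<in> carrier R" "c \<in> Units R" "d \<in> carrier R"
    and "a \<otimes> d \<oplus> b \<noteq> c \<otimes> b \<oplus> d"
  shows "has_noncommuting_pair (AGL1 R)"
  using assms commuting_AGL1_iff[of a b c d]
  unfolding has_noncommuting_pair_def carrier_AGL1 by blast

text \<open>If \<one> is the only unit, only translations remain, and these commute. A unit other
  than \<one> gives a multiplication that does not commute with the translation by \<one>.\<close>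

lemma (in cring) has_noncommuting_pair_AGL1_iff:
  "has_noncommuting_pair (AGL1 R) \<longleftrightarrow> Units R \<noteq> {\<one>}"
proof
  assume "has_noncommuting_pair (AGL1 R)"
  then obtain a b c d where abcd: "a \<in> Units R" "b \<in> carrier R" "c \<in> Units R" "d \<in> carrier R"
    and "\<not> commuting (AGL1 R) (affine_map R a b) (affine_map R c d)"
    unfolding has_noncommuting_pair_def carrier_AGL1 by blast
  then have "a \<otimes> d \<oplus> b \<noteq> c \<otimes> b \<oplus> d"
    by (simp add: commuting_AGL1_iff)
  then show "Units R \<noteq> {\<one>}"
    using abcd by (auto simp: a_comm)
next
  assume "Units R \<noteq> {\<one>}"
  then obtain a where "a \<in> Units R" "a \<noteq> \<one>"
    by blast
  then show "has_noncommuting_pair (AGL1 R)"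
    by (intro has_noncommuting_pairI[of a \<zero> \<one> \<one>]) auto
qed

text \<open>From right to left, count elements. From left to right, any \<open>x\<close> other than
  \<one> is a nonunit, hence \<open>\<one> \<ominus> x\<close> is a unit, so it equals \<one> and
  \<open>x\<close> is zero.\<close>

lemma (in local_ring) Units_trivial_iff:
  assumes fin: "finite (carrier R)"
  shows "Units R = {\<one>} \<longleftrightarrow> R \<simeq> residue_ring 2"
proof
  assume "R \<simeq> residue_ring 2"
  then have "card (carrier R) = 2"
    by (simp add: ring_iso_same_card residue_ring_def)
  moreover have "card {\<zero>, \<one>} = 2"
    using one_not_zero by simp
  ultimately have "carrier R = {\<zero>, \<one>}"
    using card_subset_eq[OF fin, of "{\<zero>, \<one>}"] by simp
  moreover have "\<zero> \<notin> Units R"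
    using one_not_zero unfolding Units_def by auto
  ultimately show "Units R = {\<one>}"
    using Units_closed by auto
next
  assume U: "Units R = {\<one>}"
  have "x = \<zero>" if x: "x \<in> carrier R" "x \<noteq> \<one>" for x
  proof -
    have "x \<oplus> (\<one> \<ominus> x) = \<one>"
      using x by algebra
    then have "\<one> \<ominus> x = \<one>"
      using nonunit_add_complement[OF fin, of x "\<one> \<ominus> x"] x U by auto
    then show ?thesis
      using \<open>x \<oplus> (\<one> \<ominus> x) = \<one>\<close> x add.r_cancel_one[of \<one> x] by simp
  qed
  then have carr: "carrier R = {\<zero>, \<one>}"
    by auto
  have two: "\<one> \<oplus> \<one> = \<zero>"
    using carr one_not_zero add.l_cancel_one[of \<one> \<one>] by fastforce
  let ?h = "\<lambda>x. if x = \<one> then 1 else 0 :: int"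
  have "?h \<in> ring_iso R (residue_ring 2)"
    by (rule ring_iso_memI)
      (use two one_not_zero in \<open>auto simp: carr residue_ring_def bij_betw_def inj_on_def
        one_not_zero[symmetric]\<close>)
  then show "R \<simeq> residue_ring 2"
    by (auto simp: is_ring_iso_def)
qed

section \<open>Vanishing determinants and the absence of squares over a local factor\<close>

text \<open>Two vectors proportional to \<open>(u, b)\<close> should be proportional to each other.
  Since \<open>u\<close> may be a zero divisor it cannot be cancelled; divisibility by
  \<open>u\<close> is used instead.\<close>

lemma (in cring) minors_vanish:
  assumes carr: "u \<in> carrier R" "b \<in> carrier R" "v0 \<in> carrier R" "d0 \<in> carrier R"
      "v1 \<in> carrier R" "d1 \<in> carrier R"
    and div: "u divides b" "u divides v0" "u divides v1"
    and minor: "u \<otimes> d0 = v0 \<otimes> b" "u \<otimes> d1 = v1 \<otimes> b"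
  shows "v0 \<otimes> d1 = v1 \<otimes> d0"
proof -
  obtain t x0 x1 where t: "t \<in> carrier R" "b = u \<otimes> t"
    and x0: "x0 \<in> carrier R" "v0 = u \<otimes> x0" and x1: "x1 \<in> carrier R" "v1 = u \<otimes> x1"
    using div by (auto elim!: dividesE)
  have "v0 \<otimes> d1 = x0 \<otimes> (u \<otimes> d1)"
    using x0 carr by (simp add: m_ac)
  \<comment> \<open>After inserting the two minors, both sides become the product of
    \<open>u\<close>, \<open>u\<close>, \<open>x0\<close>, \<open>x1\<close> and
    \<open>t\<close>.\<close>
  also have "\<dots> = x1 \<otimes> (u \<otimes> d0)"
    unfolding minor using t x0 x1 carr by (simp add: m_ac)
  also have "\<dots> = v1 \<otimes> d0"
    using x1 carr by (simp add: m_ac)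
  finally show ?thesis .
qed

text \<open>Divisibility is then a total preorder, so a minimum over a finite set exists; it will
  serve as the pivot among the eight entries of a square.\<close>

lemma (in cring) exists_least_divisor_in_set:
  assumes total: "\<And>a b. a \<in> carrier R \<Longrightarrow> b \<in> carrier R \<Longrightarrow> a divides b \<or> b divides a"
    and "finite A" "A \<noteq> {}" "A \<subseteq> carrier R"
  shows "\<exists>z\<in>A. \<forall>w\<in>A. z divides w"
  using assms(2-)
proof (induction rule: finite_ne_induct)
  case (singleton x)
  then show ?case
    using divides_refl by blast
next
  case (insert x F)
  then obtain z where z: "z \<in> F" "\<forall>w\<in>F. z divides w"
    by auto
  have xz: "x \<in> carrier R" "z \<in> carrier R"
    using insert.prems z by auto
  show ?case
  proof (cases "z divides x")
    case True
    then show ?thesis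
      using z by blast
  next
    case False
    then have "x divides z"
      using total xz by blast
    then have "\<forall>w\<in>insert x F. x divides w"
      using z xz insert.prems divides_trans divides_refl by blast
    then show ?thesis
      by blast
  qed
qed

text \<open>Both sides contain the summand \<open>d \<oplus> b\<close>. Cancelling it leaves a
  determinant condition, in which multiplier and translation play symmetric roles.\<close>

lemma (in cring) affine_commute_iff_minor:
  assumes "a \<in> carrier R" "b \<in> carrier R" "c \<in> carrier R" "d \<in> carrier R"
  shows "a \<otimes> d \<oplus> b = c \<otimes> b \<oplus> d \<longleftrightarrow> (a \<ominus> \<one>) \<otimes> d = (c \<ominus> \<one>) \<otimes> b"
proof -
  have "a \<otimes> d \<oplus> b = (a \<ominus> \<one>) \<otimes> d \<oplus> (d \<oplus> b)"
    using assms by algebra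
  moreover have "c \<otimes> b \<oplus> d = (c \<ominus> \<one>) \<otimes> b \<oplus> (d \<oplus> b)"
    using assms by algebra
  ultimately show ?thesis
    using assms by simp
qed

text \<open>Phrased with coefficients instead of maps, so that it applies directly to the
  coordinates of a square over a product.\<close>

lemma (in local_ring) no_cross_commuting_square:
  assumes fin: "finite (carrier R)" and pir: "principal_ideal_ring R"
    and carr: "a0 \<in> carrier R" "b0 \<in> carrier R" "a1 \<in> carrier R" "b1 \<in> carrier R"
      "c0 \<in> carrier R" "d0 \<in> carrier R" "c1 \<in> carrier R" "d1 \<in> carrier R"
    and comm: "a0 \<otimes> d0 \<oplus> b0 = c0 \<otimes> b0 \<oplus> d0" "a0 \<otimes> d1 \<oplus> b0 = c1 \<otimes> b0 \<oplus> d1"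
      "a1 \<otimes> d0 \<oplus> b1 = c0 \<otimes> b1 \<oplus> d0" "a1 \<otimes> d1 \<oplus> b1 = c1 \<otimes> b1 \<oplus> d1"
    and ncomm: "a0 \<otimes> b1 \<oplus> b0 \<noteq> a1 \<otimes> b0 \<oplus> b1" "c0 \<otimes> d1 \<oplus> d0 \<noteq> c1 \<otimes> d0 \<oplus> d1"
  shows False
proof -
  define u0 u1 v0 v1 where uv: "u0 = a0 \<ominus> \<one>" "u1 = a1 \<ominus> \<one>" "v0 = c0 \<ominus> \<one>" "v1 = c1 \<ominus> \<one>"
  have carr': "u0 \<in> carrier R" "u1 \<in> carrier R" "v0 \<in> carrier R" "v1 \<in> carrier R"
    using carr by (auto simp: uv)
  have eq: "u0 \<otimes> d0 = v0 \<otimes> b0" "u0 \<otimes> d1 = v1 \<otimes> b0" "u1 \<otimes> d0 = v0 \<otimes> b1" "u1 \<otimes> d1 = v1 \<otimes> b1"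
    using comm carr by (simp_all add: uv affine_commute_iff_minor)
  have neq: "u0 \<otimes> b1 \<noteq> u1 \<otimes> b0" "v0 \<otimes> d1 \<noteq> v1 \<otimes> d0"
    using ncomm carr by (simp_all add: uv affine_commute_iff_minor)
  define A where "A = {u0, u1, v0, v1, b0, b1, d0, d1}"
  have A: "A \<subseteq> carrier R" "finite A" "A \<noteq> {}"
    using carr carr' by (auto simp: A_def)
  obtain z where z: "z \<in> A" "\<And>w. w \<in> A \<Longrightarrow> z divides w"
    using exists_least_divisor_in_set[OF divides_total[OF fin pir] A(2,3,1)] by blast
  \<comment> \<open>Here \<open>(u, b)\<close> is the vector containing the pivot, and
    \<open>(p0, q0)\<close>, \<open>(p1, q1)\<close> are the two vectors of the opposite
    pair.\<close>
  have key: "p0 \<otimes> q1 = p1 \<otimes> q0"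
    if "z = u" "u \<in> A" "b \<in> A" "p0 \<in> A" "q0 \<in> A" "p1 \<in> A" "q1 \<in> A"
      "u \<otimes> q0 = p0 \<otimes> b" "u \<otimes> q1 = p1 \<otimes> b"
    for u b p0 q0 p1 q1
    by (rule minors_vanish[of u b]) (use that A(1) z(2) in blast)+
  \<comment> \<open>Swapping the coordinates of every vector lets a pivot in a translation part be
    treated like one in a multiplier.\<close>
  have eq': "b0 \<otimes> v0 = d0 \<otimes> u0" "b0 \<otimes> v1 = d1 \<otimes> u0" "b1 \<otimes> v0 = d0 \<otimes> u1" "b1 \<otimes> v1 = d1 \<otimes> u1"
    using eq carr carr' by (simp_all add: m_comm)
  have neq': "b0 \<otimes> u1 \<noteq> b1 \<otimes> u0" "d0 \<otimes> v1 \<noteq> d1 \<otimes> v0"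
    using neq carr carr' by (auto simp: m_comm)
  consider "z = u0" | "z = u1" | "z = v0" | "z = v1" | "z = b0" | "z = b1" | "z = d0" | "z = d1"
    using z(1) by (auto simp: A_def)
  then show False
  proof cases
    case 1 then show ?thesis using key[of u0 b0 v0 d0 v1 d1] eq neq by (simp add: A_def)
  next
    case 2 then show ?thesis using key[of u1 b1 v0 d0 v1 d1] eq neq by (simp add: A_def)
  next
    case 3 then show ?thesis using key[of v0 d0 u0 b0 u1 b1] eq neq by (simp add: A_def)
  next
    case 4 then show ?thesis using key[of v1 d1 u0 b0 u1 b1] eq neq by (simp add: A_def)
  next
    case 5 then show ?thesis using key[of b0 u0 d0 v0 d1 v1] eq' neq' by (simp add: A_def)
  next
    case 6 then show ?thesis using key[of b1 u1 d0 v0 d1 v1] eq' neq' by (simp add: A_def)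
  next
    case 7 then show ?thesis using key[of d0 v0 b0 u0 b1 u1] eq' neq' by (simp add: A_def)
  next
    case 8 then show ?thesis using key[of d1 v1 b0 u0 b1 u1] eq' neq' by (simp add: A_def)
  qed
qed

section \<open>Coordinates on a product of rings\<close>

text \<open>The list product is an iterated binary product: the head is the first projection, and
  every later entry is the second projection followed by a coordinate of the tail.\<close>

lemma nth_ring_hom_RDirProd_list:
  assumes "\<forall>S\<in>set Rs. ring S" "k < length Rs"
  shows "(\<lambda>xs. xs ! k) \<in> ring_hom (RDirProd_list Rs) (Rs ! k)"
  using assms
proof (induction Rs arbitrary: k)
  case (Cons S Rs)
  let ?c = "\<lambda>(a, as). a # as"
  let ?i = "Hilbert_Choice.inv ?c"
  \<comment> \<open>The inverse of consing is given by choice; injectivity fixes its value on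
    nonempty lists only.\<close>
  have inv_c: "?i (a # as) = (a, as)" for a :: 'a and as
    using inv_f_f[of ?c "(a, as)"] by (auto simp: inj_def)
  have i: "?i \<in> ring_hom (RDirProd_list (S # Rs)) (RDirProd S (RDirProd_list Rs))"
    using RDirProd_list_iso2 ring_iso_def by blast
  have list_ring: "ring (RDirProd_list (S # Rs))"
    using Cons.prems by (intro RDirProd_list_is_ring) (metis nth_mem)
  \<comment> \<open>A homomorphism on pairs is carried over to lists. The composite with
    \<open>?i\<close> agrees with \<open>g\<close> on the carrier, where all lists are nonempty, and
    this suffices.\<close>
  have descend: "g \<in> ring_hom (RDirProd_list (S # Rs)) T"
    if f: "f \<in> ring_hom (RDirProd S (RDirProd_list Rs)) T" and fg: "\<And>a as. f (a, as) = g (a # as)"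
    for f g and T :: "('a, 'b) ring_scheme"
    by (rule ring.ring_hom_restrict[OF list_ring ring_hom_trans[OF i f]])
      (auto simp: RDirProd_list_carrier inv_c fg)
  show ?case
  proof (cases k)
    case 0
    have "fst \<in> ring_hom (RDirProd S (RDirProd_list Rs)) S"
      by (auto simp: ring_hom_def RDirProd_def DirProd_def monoid.defs)
    from descend[OF this] show ?thesis
      using 0 by simp
  next
    case (Suc l)
    have "snd \<in> ring_hom (RDirProd S (RDirProd_list Rs)) (RDirProd_list Rs)"
      by (auto simp: ring_hom_def RDirProd_def DirProd_def monoid.defs)
    from descend[OF ring_hom_trans[OF this Cons.IH[of l]]] show ?thesis
      using Suc Cons.prems by (simp add: comp_def)
  qed
qed simp

text \<open>The isomorphism with the product is recorded through its coordinates: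
  \<open>proj_eqI\<close> is injectivity and \<open>proj_surj\<close> is surjectivity. Later
  arguments thus work coordinate by coordinate and never handle lists of ring elements.\<close>

locale ring_product_decomposition = cring R for R :: "('a, 'm) ring_scheme" (structure) +
  fixes Rs :: "('b, 'n) ring_scheme list" and p :: "nat \<Rightarrow> 'a \<Rightarrow> 'b"
  assumes cring_factor: "k < length Rs \<Longrightarrow> cring (Rs ! k)"
    and proj_hom: "k < length Rs \<Longrightarrow> p k \<in> ring_hom R (Rs ! k)"
    and proj_eqI: "x \<in> carrier R \<Longrightarrow> y \<in> carrier R \<Longrightarrow>
      (\<And>k. k < length Rs \<Longrightarrow> p k x = p k y) \<Longrightarrow> x = y"
    and proj_surj: "(\<And>k. k < length Rs \<Longrightarrow> f k \<in> carrier (Rs ! k)) \<Longrightarrow>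
      \<exists>x\<in>carrier R. \<forall>k<length Rs. p k x = f k"
begin

lemma proj_simps:
  assumes "k < length Rs"
  shows "x \<in> carrier R \<Longrightarrow> p k x \<in> carrier (Rs ! k)"
    and "x \<in> carrier R \<Longrightarrow> y \<in> carrier R \<Longrightarrow> p k (x \<otimes> y) = p k x \<otimes>\<^bsub>Rs ! k\<^esub> p k y"
    and "x \<in> carrier R \<Longrightarrow> y \<in> carrier R \<Longrightarrow> p k (x \<oplus> y) = p k x \<oplus>\<^bsub>Rs ! k\<^esub> p k y"
    and "p k \<one> = \<one>\<^bsub>Rs ! k\<^esub>"
  using proj_hom[OF assms] by (auto simp: ring_hom_def)

lemma proj_Units:
  assumes "k < length Rs" "x \<in> Units R"
  shows "p k x \<in> Units (Rs ! k)"
proof -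
  obtain y where "y \<in> carrier R" "x \<in> carrier R" "x \<otimes> y = \<one>" "y \<otimes> x = \<one>"
    using assms(2) unfolding Units_def by auto
  then show ?thesis
    using proj_simps[OF assms(1)] unfolding Units_def by (auto intro!: bexI[of _ "p k y"]) metis+
qed

text \<open>The coordinatewise inverses lift as well, and the product of the two lifts is \<one> in
  every coordinate.\<close>

lemma Units_lift:
  assumes f: "\<And>k. k < length Rs \<Longrightarrow> f k \<in> Units (Rs ! k)"
  shows "\<exists>x\<in>Units R. \<forall>k<length Rs. p k x = f k"
proof -
  have "\<exists>g. \<forall>k<length Rs. g k \<in> carrier (Rs ! k) \<and> f k \<otimes>\<^bsub>Rs ! k\<^esub> g k = \<one>\<^bsub>Rs ! k\<^esub>"
    using f unfolding Units_def by (intro choice) auto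
  then obtain g where g: "\<And>k. k < length Rs \<Longrightarrow> g k \<in> carrier (Rs ! k)"
      "\<And>k. k < length Rs \<Longrightarrow> f k \<otimes>\<^bsub>Rs ! k\<^esub> g k = \<one>\<^bsub>Rs ! k\<^esub>"
    by blast
  obtain x where x: "x \<in> carrier R" "\<forall>k<length Rs. p k x = f k"
    using proj_surj[of f] f unfolding Units_def by blast
  obtain y where y: "y \<in> carrier R" "\<forall>k<length Rs. p k y = g k"
    using proj_surj[of g] g by blast
  have "x \<otimes> y = \<one>"
    using x y g by (intro proj_eqI) (auto simp: proj_simps)
  then have "x \<in> Units R"
    using x y m_comm[of x y] unfolding Units_def by auto
  then show ?thesis
    using x by blast
qed

text \<open>The translation parts of the two compositions differ in \<open>R\<close>, hence in some
  coordinate, and projections preserve units.\<close>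

lemma noncommuting_factor:
  assumes "a \<in> Units R" "b \<in> carrier R" "c \<in> Units R" "d \<in> carrier R"
    and "a \<otimes> d \<oplus> b \<noteq> c \<otimes> b \<oplus> d"
  obtains k where "k < length Rs"
    "p k a \<otimes>\<^bsub>Rs ! k\<^esub> p k d \<oplus>\<^bsub>Rs ! k\<^esub> p k b \<noteq> p k c \<otimes>\<^bsub>Rs ! k\<^esub> p k b \<oplus>\<^bsub>Rs ! k\<^esub> p k d"
    "has_noncommuting_pair (AGL1 (Rs ! k))"
proof -
  have ac: "a \<in> carrier R" "c \<in> carrier R"
    using assms by auto
  obtain k where k: "k < length Rs" "p k (a \<otimes> d \<oplus> b) \<noteq> p k (c \<otimes> b \<oplus> d)"
    using proj_eqI[of "a \<otimes> d \<oplus> b" "c \<otimes> b \<oplus> d"] assms ac by auto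
  then have ne: "p k a \<otimes>\<^bsub>Rs ! k\<^esub> p k d \<oplus>\<^bsub>Rs ! k\<^esub> p k b
      \<noteq> p k c \<otimes>\<^bsub>Rs ! k\<^esub> p k b \<oplus>\<^bsub>Rs ! k\<^esub> p k d"
    using assms ac by (simp add: proj_simps)
  then have "has_noncommuting_pair (AGL1 (Rs ! k))"
    using assms k by (intro cring.has_noncommuting_pairI[OF cring_factor]) (auto simp: proj_simps proj_Units)
  then show thesis
    using that k ne by blast
qed

section \<open>Squares over a product of rings\<close>

lemma square_imp_two_noncommuting_factors:
  assumes loc: "\<And>k. k < length Rs \<Longrightarrow>
      local_ring (Rs ! k) \<and> principal_ideal_ring (Rs ! k) \<and> finite (carrier (Rs ! k))"
    and "cross_commuting_nonabelian_square (AGL1 R) F0 F1 G0 G1"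
  shows "\<exists>i<length Rs. \<exists>j<length Rs. i \<noteq> j \<and>
    has_noncommuting_pair (AGL1 (Rs ! i)) \<and> has_noncommuting_pair (AGL1 (Rs ! j))"
proof -
  have sq: "F0 \<in> carrier (AGL1 R)" "F1 \<in> carrier (AGL1 R)"
      "G0 \<in> carrier (AGL1 R)" "G1 \<in> carrier (AGL1 R)"
      "commuting (AGL1 R) F0 G0" "commuting (AGL1 R) F0 G1"
      "commuting (AGL1 R) F1 G0" "commuting (AGL1 R) F1 G1"
      "\<not> commuting (AGL1 R) F0 F1" "\<not> commuting (AGL1 R) G0 G1"
    using assms(2) unfolding cross_commuting_nonabelian_square_def by auto
  obtain a0 b0 a1 b1 c0 d0 c1 d1 where
    rep: "F0 = affine_map R a0 b0" "F1 = affine_map R a1 b1"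
      "G0 = affine_map R c0 d0" "G1 = affine_map R c1 d1"
    and U: "a0 \<in> Units R" "a1 \<in> Units R" "c0 \<in> Units R" "c1 \<in> Units R"
    and C: "b0 \<in> carrier R" "b1 \<in> carrier R" "d0 \<in> carrier R" "d1 \<in> carrier R"
    using sq(1-4) unfolding carrier_AGL1 by blast
  have UC: "a0 \<in> carrier R" "a1 \<in> carrier R" "c0 \<in> carrier R" "c1 \<in> carrier R"
    using U by auto
  have comm: "a0 \<otimes> d0 \<oplus> b0 = c0 \<otimes> b0 \<oplus> d0" "a0 \<otimes> d1 \<oplus> b0 = c1 \<otimes> b0 \<oplus> d1"
      "a1 \<otimes> d0 \<oplus> b1 = c0 \<otimes> b1 \<oplus> d0" "a1 \<otimes> d1 \<oplus> b1 = c1 \<otimes> b1 \<oplus> d1"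
    and ncomm: "a0 \<otimes> b1 \<oplus> b0 \<noteq> a1 \<otimes> b0 \<oplus> b1" "c0 \<otimes> d1 \<oplus> d0 \<noteq> c1 \<otimes> d0 \<oplus> d1"
    using sq(5-) U C by (simp_all add: rep commuting_AGL1_iff)
  obtain i where i: "i < length Rs" "has_noncommuting_pair (AGL1 (Rs ! i))"
      "p i a0 \<otimes>\<^bsub>Rs ! i\<^esub> p i b1 \<oplus>\<^bsub>Rs ! i\<^esub> p i b0 \<noteq> p i a1 \<otimes>\<^bsub>Rs ! i\<^esub> p i b0 \<oplus>\<^bsub>Rs ! i\<^esub> p i b1"
    using noncommuting_factor[OF U(1) C(1) U(2) C(2) ncomm(1)] by blast
  obtain j where j: "j < length Rs" "has_noncommuting_pair (AGL1 (Rs ! j))"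
      "p j c0 \<otimes>\<^bsub>Rs ! j\<^esub> p j d1 \<oplus>\<^bsub>Rs ! j\<^esub> p j d0 \<noteq> p j c1 \<otimes>\<^bsub>Rs ! j\<^esub> p j d0 \<oplus>\<^bsub>Rs ! j\<^esub> p j d1"
    using noncommuting_factor[OF U(3) C(3) U(4) C(4) ncomm(2)] by blast
  \<comment> \<open>If both pairs failed to commute in the same coordinate, projecting all
    coefficients there would give a square over one local factor.\<close>
  have "i \<noteq> j"
  proof
    assume "i = j"
    interpret S: local_ring "Rs ! i"
      using loc i by blast
    have img: "p i a \<otimes>\<^bsub>Rs ! i\<^esub> p i d \<oplus>\<^bsub>Rs ! i\<^esub> p i b = p i c \<otimes>\<^bsub>Rs ! i\<^esub> p i b \<oplus>\<^bsub>Rs ! i\<^esub> p i d"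
      if "a \<otimes> d \<oplus> b = c \<otimes> b \<oplus> d" "a \<in> carrier R" "b \<in> carrier R" "c \<in> carrier R" "d \<in> carrier R"
      for a b c d
    proof -
      have "p i (a \<otimes> d \<oplus> b) = p i (c \<otimes> b \<oplus> d)"
        using that(1) by simp
      then show ?thesis
        using that(2-) i(1) by (simp add: proj_simps)
    qed
    show False
      by (rule S.no_cross_commuting_square[OF _ _ _ _ _ _ _ _ _ _
            img[OF comm(1) UC(1) C(1) UC(3) C(3)] img[OF comm(2) UC(1) C(1) UC(4) C(4)]
            img[OF comm(3) UC(2) C(2) UC(3) C(3)] img[OF comm(4) UC(2) C(2) UC(4) C(4)]
            i(3) j(3)[folded \<open>i = j\<close>]])
        (use loc[OF i(1)] UC C proj_simps(1)[OF i(1)] in auto)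
  qed
  then show ?thesis
    using i j by blast
qed

text \<open>Each pair consists of a multiplication and a translation supported in a single factor.
  The two supports are disjoint, so the pairs commute with each other.\<close>

lemma two_noncommuting_factors_imp_square:
  assumes ij: "i < length Rs" "j < length Rs" "i \<noteq> j"
    and nc: "has_noncommuting_pair (AGL1 (Rs ! i))" "has_noncommuting_pair (AGL1 (Rs ! j))"
  shows "\<exists>F0 F1 G0 G1. cross_commuting_nonabelian_square (AGL1 R) F0 F1 G0 G1"
proof -
  \<comment> \<open>Take \<open>e\<close> to be a nontrivial unit at \<open>l\<close> and one
    elsewhere, and \<open>s\<close> to be one at \<open>l\<close> and zero elsewhere. Then
    \<open>e \<otimes> s\<close> and \<open>s\<close> differ at \<open>l\<close>.\<close>
  have local_unit: "\<exists>e\<in>Units R. \<exists>s\<in>carrier R.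
      (\<forall>k<length Rs. k \<noteq> l \<longrightarrow> p k e = \<one>\<^bsub>Rs ! k\<^esub> \<and> p k s = \<zero>\<^bsub>Rs ! k\<^esub>) \<and> e \<otimes> s \<noteq> s"
    if l: "l < length Rs" and nc: "has_noncommuting_pair (AGL1 (Rs ! l))" for l
  proof -
    interpret S: cring "Rs ! l"
      using cring_factor l .
    have const_closed: "\<one>\<^bsub>Rs ! k\<^esub> \<in> Units (Rs ! k)" "\<one>\<^bsub>Rs ! k\<^esub> \<in> carrier (Rs ! k)"
        "\<zero>\<^bsub>Rs ! k\<^esub> \<in> carrier (Rs ! k)" if "k < length Rs" for k
    proof -
      interpret T: cring "Rs ! k"
        using cring_factor that .
      show "\<one>\<^bsub>Rs ! k\<^esub> \<in> Units (Rs ! k)" "\<one>\<^bsub>Rs ! k\<^esub> \<in> carrier (Rs ! k)"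
        "\<zero>\<^bsub>Rs ! k\<^esub> \<in> carrier (Rs ! k)"
        by auto
    qed
    obtain a where a: "a \<in> Units (Rs ! l)" "a \<noteq> \<one>\<^bsub>Rs ! l\<^esub>"
      using nc S.has_noncommuting_pair_AGL1_iff S.Units_one_closed by blast
    have "\<exists>e\<in>Units R. \<forall>k<length Rs. p k e = (if k = l then a else \<one>\<^bsub>Rs ! k\<^esub>)"
      by (rule Units_lift) (use a const_closed in auto)
    then obtain e where
      e: "e \<in> Units R" "\<forall>k<length Rs. p k e = (if k = l then a else \<one>\<^bsub>Rs ! k\<^esub>)"
      by blast
    have "\<exists>s\<in>carrier R. \<forall>k<length Rs. p k s = (if k = l then \<one>\<^bsub>Rs ! k\<^esub> else \<zero>\<^bsub>Rs ! k\<^esub>)"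
      by (rule proj_surj) (use const_closed in auto)
    then obtain s where s: "s \<in> carrier R"
        "\<forall>k<length Rs. p k s = (if k = l then \<one>\<^bsub>Rs ! k\<^esub> else \<zero>\<^bsub>Rs ! k\<^esub>)"
      by blast
    have "p l (e \<otimes> s) = a" "p l s = \<one>\<^bsub>Rs ! l\<^esub>"
      using l a e s by (simp_all add: proj_simps Units_closed S.Units_closed)
    then have "e \<otimes> s \<noteq> s"
      using a by metis
    then show ?thesis
      using e s by (intro bexI[of _ e] bexI[of _ s]) auto
  qed
  obtain e s where e: "e \<in> Units R" and s: "s \<in> carrier R" and es: "e \<otimes> s \<noteq> s"
    and es_proj: "\<And>k. k < length Rs \<Longrightarrow> k \<noteq> i \<Longrightarrow> p k e = \<one>\<^bsub>Rs ! k\<^esub> \<and> p k s = \<zero>\<^bsub>Rs ! k\<^esub>"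
    using local_unit[OF ij(1) nc(1)] by blast
  obtain f t where f: "f \<in> Units R" and t: "t \<in> carrier R" and ft: "f \<otimes> t \<noteq> t"
    and ft_proj: "\<And>k. k < length Rs \<Longrightarrow> k \<noteq> j \<Longrightarrow> p k f = \<one>\<^bsub>Rs ! k\<^esub> \<and> p k t = \<zero>\<^bsub>Rs ! k\<^esub>"
    using local_unit[OF ij(2) nc(2)] by blast
  have act_trivially: "x \<otimes> y = y"
    if "x \<in> Units R" "y \<in> carrier R"
      "\<And>k. k < length Rs \<Longrightarrow> p k x = \<one>\<^bsub>Rs ! k\<^esub> \<or> p k y = \<zero>\<^bsub>Rs ! k\<^esub>" for x y
  proof (rule proj_eqI)
    fix k assume k: "k < length Rs"
    interpret S: cring "Rs ! k"
      using cring_factor k .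
    show "p k (x \<otimes> y) = p k y"
      using that(3)[OF k] that(1,2) k proj_simps(1)[OF k] by (auto simp: proj_simps Units_closed)
  qed (use that in auto)
  \<comment> \<open>Away from \<open>i\<close> the coordinate of \<open>e\<close> is one; at
    \<open>i\<close>, which differs from \<open>j\<close>, that of \<open>t\<close> is zero. The
    other equation is symmetric.\<close>
  have et: "e \<otimes> t = t" and fs: "f \<otimes> s = s"
    using es_proj ft_proj ij(3) e f s t by (intro act_trivially; metis)+
  \<comment> \<open>Multiplications commute, translations commute, and multiplication by
    \<open>x\<close> commutes with translation by \<open>y\<close> exactly when
    \<open>x \<otimes> y = y\<close>.\<close>
  have "cross_commuting_nonabelian_square (AGL1 R)
      (affine_map R e \<zero>) (affine_map R \<one> s) (affine_map R f \<zero>) (affine_map R \<one> t)"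
    using e f s t es ft et fs unfolding cross_commuting_nonabelian_square_def
    by (auto simp: commuting_AGL1_iff a_comm carrier_AGL1 Units_closed)
  then show ?thesis
    by blast
qed

end

text \<open>The projections are the entries of the image list under an isomorphism
  \<open>h\<close>.\<close>

lemma ring_product_decomposition_of_iso:
  assumes "cring R" "\<forall>S\<in>set Rs. cring S" "R \<simeq> RDirProd_list Rs"
  shows "\<exists>p. ring_product_decomposition R Rs p"
proof -
  interpret cring R by fact
  have rings: "\<forall>S\<in>set Rs. ring S"
    using assms(2) cring.axioms(1) by blast
  obtain h where h: "h \<in> ring_hom R (RDirProd_list Rs)"
    and bij: "bij_betw h (carrier R) (carrier (RDirProd_list Rs))"
    using assms(3) by (auto simp: is_ring_iso_def ring_iso_def)
  have "ring_product_decomposition R Rs (\<lambda>k x. h x ! k)"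
  proof (intro ring_product_decomposition.intro ring_product_decomposition_axioms.intro cring_axioms)
    fix k assume k: "k < length Rs"
    then show "cring (Rs ! k)"
      using assms(2) by simp
    show "(\<lambda>x. h x ! k) \<in> ring_hom R (Rs ! k)"
      using ring_hom_trans[OF h nth_ring_hom_RDirProd_list[OF rings k]] by (simp add: comp_def)
  next
    fix x y assume xy: "x \<in> carrier R" "y \<in> carrier R"
      and eq: "\<And>k. k < length Rs \<Longrightarrow> h x ! k = h y ! k"
    have "length (h z) = length Rs" if "z \<in> carrier R" for z
      using RDirProd_list_carrier_mem(1) ring_hom_closed[OF h that] by blast
    then have "h x = h y"
      using xy eq by (intro nth_equalityI) auto
    then show "x = y"
      using bij xy by (auto simp: bij_betw_def dest: inj_onD)
  next
    fix f assume f: "\<And>k. k < length Rs \<Longrightarrow> f k \<in> carrier (Rs ! k)"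
    then have "map f [0..<length Rs] \<in> carrier (RDirProd_list Rs)"
      by (intro RDirProd_list_carrier_memI) auto
    then obtain x where "x \<in> carrier R" "h x = map f [0..<length Rs]"
      using bij unfolding bij_betw_def by (metis imageE)
    then show "\<exists>x\<in>carrier R. \<forall>k<length Rs. h x ! k = f k"
      by (intro bexI[of _ x]) auto
  qed
  then show ?thesis
    by blast
qed

theorem theorem4p4:
  fixes R :: "('a, 'm) ring_scheme" and Rs :: "('b, 'n) ring_scheme list"
  assumes "principal_ideal_ring R" and "finite (carrier R)"
    and "\<forall>S \<in> set Rs. local_ring S \<and> principal_ideal_ring S \<and> finite (carrier S)"
    and "R \<simeq> RDirProd_list Rs"
  shows "((\<exists>F0 F1 G0 G1. cross_commuting_nonabelian_square (AGL1 R) F0 F1 G0 G1) \<longleftrightarrow>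
          (\<exists>i < length Rs. \<exists>j < length Rs. i \<noteq> j \<and>
             has_noncommuting_pair (AGL1 (Rs ! i)) \<and> has_noncommuting_pair (AGL1 (Rs ! j)))) \<and>
         ((\<exists>i < length Rs. \<exists>j < length Rs. i \<noteq> j \<and>
             has_noncommuting_pair (AGL1 (Rs ! i)) \<and> has_noncommuting_pair (AGL1 (Rs ! j))) \<longleftrightarrow>
          2 \<le> card {k. k < length Rs \<and> \<not> Rs ! k \<simeq> residue_ring 2})"
proof -
  have loc: "local_ring (Rs ! k) \<and> principal_ideal_ring (Rs ! k) \<and> finite (carrier (Rs ! k))"
    if "k < length Rs" for k
    using assms(3) that by simp
  obtain p where "ring_product_decomposition R Rs p"
    using ring_product_decomposition_of_iso[of R Rs] assms
      principal_ideal_ring.axioms(1)[of R] local_ring.axioms(1) by metis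
  then interpret ring_product_decomposition R Rs p .
  let ?nc = "\<lambda>k. has_noncommuting_pair (AGL1 (Rs ! k))"
  let ?K = "{k. k < length Rs \<and> \<not> Rs ! k \<simeq> residue_ring 2}"
  have nc_iff: "?nc k \<longleftrightarrow> \<not> Rs ! k \<simeq> residue_ring 2" if "k < length Rs" for k
    \<comment> \<open>Both conditions say that the local factor has a unit other than
      \<one>.\<close>
    using loc[OF that] cring.has_noncommuting_pair_AGL1_iff[OF cring_factor[OF that]]
      local_ring.Units_trivial_iff by blast
  \<comment> \<open>The negation, cardinality at most one, means that any two elements of this
    finite set coincide.\<close>
  have "2 \<le> card ?K \<longleftrightarrow> (\<exists>i\<in>?K. \<exists>j\<in>?K. i \<noteq> j)"
    using card_le_Suc0_iff_eq[of ?K] by (simp only: numeral_2_eq_2 not_less_eq_eq[symmetric]) auto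
  also have "\<dots> \<longleftrightarrow> (\<exists>i < length Rs. \<exists>j < length Rs. i \<noteq> j \<and> ?nc i \<and> ?nc j)"
    using nc_iff by blast
  finally show ?thesis
    using square_imp_two_noncommuting_factors[OF loc] two_noncommuting_factors_imp_square
    by blast
qed

end
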